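(* Let $A$ be any set and $u\le w$ in $A^*$ under ordinary factor order. Then the order complex $\Delta(u,w)$ is homotopy equivalent to a sphere or is contractible.
   Context: $A^*$ is the set of finite words over $A$. Ordinary factor order: $u\le w$ iff $u=w(i+1)w(i+2)\cdots w(i+|u|)$ for some $i\ge 0$. $\Delta(u,w)$ is the simplicial complex whose simplices are the chains of the open interval $(u,w)$. *)

theory Defs
  imports "HOL-Analysis.Analysis" "HOL-Library.Sublist"
begin

text \<open>The factor order is the library order \<^const>\<open>sublist\<close> (contiguous sublists).\<close>

lemma sublist_iff_positions:
  "sublist u w \<longleftrightarrow>
     (\<exists>i. i + length u \<le> length w \<and> (\<forall>k<length u. u ! k = w ! (i + k)))"
proof
  assume "sublist u w"
  then obtain p s where w: "w = p @ u @ s"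
    by (auto simp: sublist_def)
  have "length p + length u \<le> length w \<and> (\<forall>k<length u. u ! k = w ! (length p + k))"
    by (auto simp: w nth_append)
  then show "\<exists>i. i + length u \<le> length w \<and> (\<forall>k<length u. u ! k = w ! (i + k))"
    by blast
next
  assume "\<exists>i. i + length u \<le> length w \<and> (\<forall>k<length u. u ! k = w ! (i + k))"
  then obtain i where i: "i + length u \<le> length w" "\<forall>k<length u. u ! k = w ! (i + k)"
    by blast
  have "u = take (length u) (drop i w)"
    using i by (intro nth_equalityI) auto
  moreover have "w = take i w @ take (length u) (drop i w) @ drop (length u) (drop i w)"
    by (simp only: append_take_drop_id)
  ultimately show "sublist u w"
    unfolding sublist_def by metis
qed

definition factor_interval :: "'a set \<Rightarrow> 'a list \<Rightarrow> 'a list \<Rightarrow> 'a list set" where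
  "factor_interval A u w = {v \<in> lists A. strict_sublist u v \<and> strict_sublist v w}"

lemma finite_factor_interval: "finite (factor_interval A u w)"
proof (rule finite_subset)
  show "factor_interval A u w \<subseteq> {v. set v \<subseteq> set w \<and> length v \<le> length w}"
    by (auto simp: factor_interval_def strict_sublist_def sublist_def)
  show "finite {v. set v \<subseteq> set w \<and> length v \<le> length w}"
    by (rule finite_lists_length_le) simp
qed

text \<open>The empty chain is included as the empty simplex.\<close>

definition order_complex :: "('v \<Rightarrow> 'v \<Rightarrow> bool) \<Rightarrow> 'v set \<Rightarrow> 'v set set" where
  "order_complex le P = {C. finite C \<and> C \<subseteq> P \<and> Complete_Partial_Order.chain le C}"

text \<open>
  The geometric realization in barycentric coordinates. The product topology is the usual
  (weak) topology when the complex has finitely many vertices, which is the case for order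
  complexes of intervals in the factor order by \<open>finite_factor_interval\<close>. The realization
  of the complex whose only simplex is the empty one is the empty space.
\<close>

definition geometric_realization :: "'v set set \<Rightarrow> ('v \<Rightarrow> real) topology" where
  "geometric_realization K =
     subtopology (powertop_real UNIV)
       {x. (\<forall>v. 0 \<le> x v) \<and> {v. x v \<noteq> 0} \<in> K \<and> (\<Sum>v | x v \<noteq> 0. x v) = 1}"

definition factor_order_complex :: "'a set \<Rightarrow> 'a list \<Rightarrow> 'a list \<Rightarrow> 'a list set set"
  where "factor_order_complex A u w = order_complex sublist (factor_interval A u w)"

text \<open>
  The sphere of dimension \<open>d \<ge> -1\<close>; the sphere of dimension \<open>-1\<close> is the empty space, which is
  what the order complex of an empty open interval realizes to.
\<close>

definition sphere_space :: "int \<Rightarrow> (nat \<Rightarrow> real) topology" where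
  "sphere_space d = (if d < 0 then trivial_topology else nsphere (nat d))"

text \<open>
  The library's \<^const>\<open>contractible_space\<close> also holds for the empty space, which is not
  homotopy equivalent to a point and has to be excluded.
\<close>

definition contractible_nonempty_space :: "'b topology \<Rightarrow> bool" where
  "contractible_nonempty_space X \<longleftrightarrow> topspace X \<noteq> {} \<and> contractible_space X"

end

theory Submission
  imports Defs
begin

text \<open>
  Write \<open>w = a x b\<close> with letters \<open>a\<close>, \<open>b\<close>, and put \<open>p = a x\<close>, \<open>s = x b\<close>. Every proper factor of \<open>w\<close>
  lies below \<open>p\<close> or \<open>s\<close>; the words below both are the factors of \<open>x\<close> and of the longest proper
  border \<open>z\<close> of \<open>w\<close>; and every proper factor of \<open>z\<close> is a factor of \<open>x\<close>. If a finite poset has two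
  elements such that everything lies below one of them, pushing the elements that are not below both
  up to the one above them is a deformation retraction onto the common lower part with the two
  elements put on top. Hence, unless a cone point appears on the way, the open interval \<open>(u, w)\<close>
  retracts onto the ordinal sum of \<open>(u, z)\<close> with the antichains \<open>{x, z}\<close> and \<open>{p, s}\<close>, or onto
  \<open>{p, s}\<close> alone. By induction \<open>(u, w)\<close> retracts onto a poset with a cone point or onto an ordinal
  sum of two-element antichains, whose order complex is the boundary of a cross-polytope.
\<close>

section \<open>Retractions and cones in geometric realizations\<close>

text \<open>Trades the sum over the support, which varies with the point, for a sum over a fixed
  finite set, which is linear and continuous in the coordinates.\<close>

lemma geometric_realization_finite:
  assumes "finite V" "K \<subseteq> Pow V"
  shows "geometric_realization K = subtopology (powertop_real UNIV)
           {x. (\<forall>v. 0 \<le> x v) \<and> {v. x v \<noteq> 0} \<in> K \<and> sum x V = 1}"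
proof -
  have "(\<Sum>v | x v \<noteq> 0. x v) = sum x V" if "{v. x v \<noteq> 0} \<in> K" for x :: "'a \<Rightarrow> real"
    by (rule sum.mono_neutral_left) (use assms that in auto)
  then show ?thesis
    unfolding geometric_realization_def by (metis (mono_tags, lifting))
qed

lemma continuous_map_real_coordinate [continuous_intros]:
  "continuous_map (subtopology (powertop_real UNIV) S) euclideanreal (\<lambda>x. x i)"
  by (intro continuous_map_from_subtopology continuous_map_product_projection) simp

text \<open>Pushing barycentric coordinates forward along \<open>f\<close> retracts the realization.
  By \<open>contig\<close> a point and its image lie in a common simplex, so the segment between
  them stays in the realization and gives the homotopy to the identity.\<close>

lemma geometric_realization_retract:
  assumes V: "finite V" "K \<subseteq> Pow V"
    and down: "\<And>C D. C \<in> K \<Longrightarrow> D \<subseteq> C \<Longrightarrow> D \<in> K"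
    and fV: "f ` V \<subseteq> R" and RV: "R \<subseteq> V" and fR: "\<And>v. v \<in> R \<Longrightarrow> f v = v"
    and contig: "\<And>C. C \<in> K \<Longrightarrow> C \<union> f ` C \<in> K"
  shows "geometric_realization K homotopy_equivalent_space
         geometric_realization {C \<in> K. C \<subseteq> R}"
proof -
  \<comment> \<open>The weight of each vertex \<open>u\<close> moves to \<open>f u\<close>. The
    fibre sum is written as a conditional sum over \<open>V\<close>, so continuity is that of a
    finite sum and the total weight follows by swapping sums.\<close>
  define r :: "('a \<Rightarrow> real) \<Rightarrow> 'a \<Rightarrow> real"
    where "r x v = (\<Sum>u\<in>V. if f u = v then x u else 0)" for x v
  let ?X = "{x. (\<forall>v. 0 \<le> x v) \<and> {v. x v \<noteq> 0} \<in> K \<and> sum x V = (1::real)}"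
  let ?Y = "{x. (\<forall>v. 0 \<le> x v) \<and> {v. x v \<noteq> 0} \<in> {C \<in> K. C \<subseteq> R} \<and> sum x V = (1::real)}"
  have X: "geometric_realization K = subtopology (powertop_real UNIV) ?X"
    by (rule geometric_realization_finite[OF V])
  have Y: "geometric_realization {C \<in> K. C \<subseteq> R} = subtopology (powertop_real UNIV) ?Y"
    by (rule geometric_realization_finite[OF V(1)]) (use V(2) in auto)
  have r_nonneg: "0 \<le> r x v" if "x \<in> ?X" for x v
    using that unfolding r_def by (auto intro!: sum_nonneg)
  have r_supp: "{v. r x v \<noteq> 0} \<subseteq> f ` {v. x v \<noteq> 0}" for x
  proof
    fix v assume "v \<in> {v. r x v \<noteq> 0}"
    then obtain u where "u \<in> V" "(if f u = v then x u else 0) \<noteq> 0"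
      unfolding r_def by (blast elim: sum.not_neutral_contains_not_neutral)
    then show "v \<in> f ` {v. x v \<noteq> 0}"
      by (auto split: if_splits)
  qed
  have r_sum: "sum (r x) V = sum x V" for x
  proof -
    have "sum (r x) V = (\<Sum>u\<in>V. \<Sum>v\<in>V. if f u = v then x u else 0)"
      unfolding r_def by (rule sum.swap)
    also have "\<dots> = sum x V"
      using V(1) fV RV by (intro sum.cong) auto
    finally show ?thesis .
  qed
  have r_id: "r x = x" if "x \<in> ?Y" for x
  proof
    fix v
    have "r x v = (\<Sum>u\<in>V. if u = v then x u else 0)"
      unfolding r_def using that fR by (intro sum.cong refl) (smt (verit) Collect_mono_iff mem_Collect_eq subset_iff)
    also have "\<dots> = x v"
      using V that by auto
    finally show "r x v = x v" .
  qed
  have r_Y: "r x \<in> ?Y" if x: "x \<in> ?X" for x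
  proof -
    have "{v. r x v \<noteq> 0} \<in> K"
      using x r_supp[of x] contig[of "{v. x v \<noteq> 0}"] by (blast intro: down)
    moreover have "f ` {v. x v \<noteq> 0} \<subseteq> R"
      using x V fV by blast
    ultimately show ?thesis
      using x r_nonneg[OF x] r_supp[of x] r_sum[of x] by auto
  qed
  have segment: "(\<lambda>v. (1 - t) * r x v + t * x v) \<in> ?X" if x: "x \<in> ?X" and t: "0 \<le> t" "t \<le> 1" for t x
  proof -
    have "{v. (1 - t) * r x v + t * x v \<noteq> 0} \<subseteq> {v. x v \<noteq> 0} \<union> f ` {v. x v \<noteq> 0}"
      using r_supp[of x] by force
    then have "{v. (1 - t) * r x v + t * x v \<noteq> 0} \<in> K"
      using x contig[of "{v. x v \<noteq> 0}"] by (blast intro: down)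
    moreover have "(\<Sum>v\<in>V. (1 - t) * r x v + t * x v) = (1 - t) * sum (r x) V + t * sum x V"
      by (simp add: sum.distrib sum_distrib_left)
    ultimately show ?thesis
      using x t r_nonneg[OF x] r_sum[of x] by auto
  qed
  have r_cont: "continuous_map (subtopology (powertop_real UNIV) ?X) euclideanreal (\<lambda>x. r x v)" for v
  proof -
    have "continuous_map (subtopology (powertop_real UNIV) ?X) euclideanreal
            (\<lambda>x. if f u = v then x u else 0)" for u
      by (cases "f u = v") (simp_all add: continuous_map_real_coordinate)
    then show ?thesis
      unfolding r_def by (intro continuous_map_sum V(1))
  qed
  let ?P = "prod_topology (top_of_set {0..1::real}) (subtopology (powertop_real UNIV) ?X)"
  have "homotopic_with (\<lambda>_. True) (subtopology (powertop_real UNIV) ?X) (subtopology (powertop_real UNIV) ?X) r id"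
    unfolding homotopic_with_def
  proof (intro exI[of _ "\<lambda>(t, x) v. (1 - t) * r x v + t * x v"] conjI)
    have fst: "continuous_map ?P euclideanreal fst"
      using continuous_map_fst continuous_map_into_fulltopology by blast
    have "continuous_map ?P euclideanreal (\<lambda>z. (1 - fst z) * r (snd z) v + fst z * snd z v)" for v
      by (intro continuous_intros fst
          continuous_map_compose[OF continuous_map_snd r_cont[of v], unfolded o_def]
          continuous_map_compose[OF continuous_map_snd continuous_map_real_coordinate, unfolded o_def])
    then show "continuous_map ?P (subtopology (powertop_real UNIV) ?X)
                 (\<lambda>(t, x) v. (1 - t) * r x v + t * x v)"
      unfolding continuous_map_in_subtopology continuous_map_componentwise_UNIV
      using segment by (auto simp: case_prod_unfold)
  qed auto
  moreover have "retraction_maps (subtopology (powertop_real UNIV) ?X) (subtopology (powertop_real UNIV) ?Y) r id"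
    unfolding retraction_maps_def
  proof (intro conjI)
    show "continuous_map (subtopology (powertop_real UNIV) ?X) (subtopology (powertop_real UNIV) ?Y) r"
      unfolding continuous_map_in_subtopology continuous_map_componentwise_UNIV
      using r_cont r_Y by auto
    show "continuous_map (subtopology (powertop_real UNIV) ?Y) (subtopology (powertop_real UNIV) ?X) id"
      unfolding continuous_map_in_subtopology continuous_map_componentwise_UNIV
      by (auto intro: continuous_map_real_coordinate)
  qed (use r_id in auto)
  ultimately show ?thesis
    unfolding X Y by (rule deformation_retract_imp_homotopy_equivalent_space)
qed

text \<open>The constant map to \<open>m\<close> is contiguous to the identity because
  \<open>m\<close> can be added to every simplex; so the realization retracts onto the vertex
  \<open>m\<close>.\<close>

lemma geometric_realization_cone:
  assumes V: "finite V" "K \<subseteq> Pow V"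
    and down: "\<And>C D. C \<in> K \<Longrightarrow> D \<subseteq> C \<Longrightarrow> D \<in> K"
    and m: "{m} \<in> K" and cone: "\<And>C. C \<in> K \<Longrightarrow> insert m C \<in> K"
  shows "contractible_nonempty_space (geometric_realization K)"
proof -
  let ?L = "{C \<in> K. C \<subseteq> {m}}"
  have he: "geometric_realization K homotopy_equivalent_space geometric_realization ?L"
  proof (rule geometric_realization_retract[OF V, where f = "\<lambda>_. m"])
    show "C \<union> (\<lambda>_. m) ` C \<in> K" if "C \<in> K" for C
      by (rule down[OF cone[OF that]]) auto
  qed (use V m down in auto)
  have L: "geometric_realization ?L = subtopology (powertop_real UNIV)
          {x. (\<forall>v. 0 \<le> x v) \<and> {v. x v \<noteq> 0} \<in> ?L \<and> sum x {m} = 1}"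
    by (rule geometric_realization_finite) auto
  have eq: "{x. (\<forall>v. 0 \<le> x v) \<and> {v. x v \<noteq> 0} \<in> ?L \<and> sum x {m} = 1}
      = {\<lambda>v. if v = m then 1 else (0::real)}" (is "?l = {?e}")
  proof -
    have "?e \<in> ?l" using m by (auto split: if_splits)
    moreover have "x = ?e" if "x \<in> ?l" for x
      using that by (auto simp: fun_eq_iff)
    ultimately show ?thesis by blast
  qed
  have "contractible_space (geometric_realization ?L)"
    unfolding L eq by (rule contractible_space_subset_singleton) auto
  then have "contractible_space (geometric_realization K)"
    using homotopy_equivalent_space_contractibility[OF he] by blast
  moreover have "topspace (geometric_realization K) \<noteq> {}"
  proof -
    have "(\<lambda>v. if v = m then 1 else 0) \<in> topspace (geometric_realization K)"
      using m by (auto simp: geometric_realization_def)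
    then show ?thesis by blast
  qed
  ultimately show ?thesis
    by (simp add: contractible_nonempty_space_def)
qed

section \<open>Ordinal sums of two-element antichains\<close>

text \<open>Level \<open>j\<close> is the pair \<open>a j\<close>, \<open>b j\<close>, and
  \<open>k = 0\<close> gives the empty poset. Chains only see comparability, so the upward relations
  between levels suffice.\<close>

definition antichain_tower :: "('v \<Rightarrow> 'v \<Rightarrow> bool) \<Rightarrow> nat \<Rightarrow> (nat \<Rightarrow> 'v) \<Rightarrow> (nat \<Rightarrow> 'v) \<Rightarrow> bool" where
  "antichain_tower le k a b \<longleftrightarrow>
     (\<forall>j<k. \<not> le (a j) (b j) \<and> \<not> le (b j) (a j)) \<and>
     (\<forall>j<k. \<forall>i<j. le (a i) (a j) \<and> le (a i) (b j) \<and> le (b i) (a j) \<and> le (b i) (b j))"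

text \<open>A chain uses at most one element of each level, and every such choice is a chain because
  distinct levels are comparable. These are the simplices of the boundary of a
  cross-polytope.\<close>

lemma order_complex_antichain_tower:
  assumes le: "reflp le" and tower: "antichain_tower le k a b"
  shows "order_complex le (a ` {..<k} \<union> b ` {..<k}) =
         {C. C \<subseteq> a ` {..<k} \<union> b ` {..<k} \<and> (\<forall>j<k. a j \<notin> C \<or> b j \<notin> C)}"
  (is "_ = ?K")
proof (intro equalityI subsetI)
  fix C assume "C \<in> order_complex le (a ` {..<k} \<union> b ` {..<k})"
  then have C: "C \<subseteq> a ` {..<k} \<union> b ` {..<k}" "\<And>x y. x \<in> C \<Longrightarrow> y \<in> C \<Longrightarrow> le x y \<or> le y x"
    by (auto simp: order_complex_def Complete_Partial_Order.chain_def)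
  have "a j \<notin> C \<or> b j \<notin> C" if "j < k" for j
    using tower that C(2)[of "a j" "b j"] by (auto simp: antichain_tower_def)
  then show "C \<in> ?K"
    using C(1) by blast
next
  fix C assume C: "C \<in> ?K"
  have "le x y \<or> le y x" if xy: "x \<in> C" "y \<in> C" for x y
  proof -
    obtain i where i: "i < k" "x = a i \<or> x = b i" using C xy by auto
    obtain j where j: "j < k" "y = a j \<or> y = b j" using C xy by auto
    show ?thesis
    proof (cases i j rule: linorder_cases)
      case equal
      then have "x = y" using i j C xy by auto
      then show ?thesis using le by (auto dest: reflpD)
    qed (use i j tower in \<open>auto simp: antichain_tower_def\<close>)
  qed
  moreover have "finite C"
    using C by (auto intro: finite_subset)
  ultimately show "C \<in> order_complex le (a ` {..<k} \<union> b ` {..<k})"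
    using C by (auto simp: order_complex_def Complete_Partial_Order.chain_def)
qed

text \<open>An element occurring on two levels would, as a member of the lower one, lie below both
  elements of the upper one and so be comparable with its own partner. Partners on one level differ
  by reflexivity.\<close>

lemma antichain_tower_distinct:
  assumes le: "reflp le" and tower: "antichain_tower le k a b" and "i < k" "j < k"
  shows "a i \<noteq> b j" "a i = a j \<longleftrightarrow> i = j" "b i = b j \<longleftrightarrow> i = j"
proof -
  have incomparable: "\<not> le (a l) (b l)" "\<not> le (b l) (a l)" if "l < k" for l
    using tower that by (auto simp: antichain_tower_def)
  have below: "le (a l) (b m)" "le (b l) (a m)" "le (a l) (a m)" "le (b l) (b m)" if "l < m" "m < k" for l m
    using tower that by (auto simp: antichain_tower_def)
  show "a i \<noteq> b j"
    using incomparable below reflpD[OF le] assms(3,4) by (metis linorder_less_linear)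
  show "a i = a j \<longleftrightarrow> i = j" "b i = b j \<longleftrightarrow> i = j"
    using incomparable below assms(3,4) by (metis linorder_less_linear)+
qed

text \<open>
  The coordinates \<open>x (a j) - x (b j)\<close> identify the realization with the unit sphere of the
  \<open>\<ell>\<^sub>1\<close>-norm, which is projected radially onto the Euclidean one.
\<close>

lemma geometric_realization_antichain_tower:
  fixes le :: "'v \<Rightarrow> 'v \<Rightarrow> bool"
  assumes le: "reflp le" and tower: "antichain_tower le (Suc n) a b"
  shows "geometric_realization (order_complex le (a ` {..<Suc n} \<union> b ` {..<Suc n}))
         homeomorphic_space nsphere n"
proof -
  let ?R = "a ` {..<Suc n} \<union> b ` {..<Suc n}"
  let ?X = "{x. (\<forall>v. 0 \<le> x v) \<and> {v. x v \<noteq> 0} \<in> order_complex le ?R \<and> sum x ?R = (1::real)}"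
  let ?Y = "{y. (\<Sum>i\<le>n. y i ^ 2) = 1 \<and> (\<forall>i>n. y i = (0::real))}"
  have X: "geometric_realization (order_complex le ?R) = subtopology (powertop_real UNIV) ?X"
    by (rule geometric_realization_finite) (auto simp: order_complex_def)
  note distinct = antichain_tower_distinct[OF le tower]
  have sum_R: "sum x ?R = (\<Sum>j\<le>n. x (a j) + x (b j))" for x :: "'v \<Rightarrow> real"
  proof -
    have "inj_on a {..<Suc n}" "inj_on b {..<Suc n}" "a ` {..<Suc n} \<inter> b ` {..<Suc n} = {}"
      using distinct by (auto intro!: inj_onI)
    then show ?thesis
      by (simp add: sum.union_disjoint sum.reindex sum.distrib lessThan_Suc_atMost)
  qed
  define d :: "('v \<Rightarrow> real) \<Rightarrow> nat \<Rightarrow> real" where "d x j = x (a j) - x (b j)" for x j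
  \<comment> \<open>The value 0 beyond \<open>n\<close> matches \<open>nsphere n\<close>, whose
    points are sequences vanishing there.\<close>
  define f where "f x j = (if j \<le> n then d x j / sqrt (\<Sum>i\<le>n. (d x i)\<^sup>2) else 0)" for x j
  \<comment> \<open>The inverse before normalization: the positive part of \<open>y j\<close> goes
    to \<open>a j\<close>, the negative part to \<open>b j\<close>. Dividing by the l1-norm in
    \<open>g\<close> makes the weights sum to 1.\<close>
  define g0 :: "(nat \<Rightarrow> real) \<Rightarrow> 'v \<Rightarrow> real"
    where "g0 y v = (\<Sum>j\<le>n. if v = a j then max 0 (y j) else if v = b j then max 0 (- y j) else 0)" for y v
  define g where "g y v = g0 y v / (\<Sum>j\<le>n. \<bar>y j\<bar>)" for y v
  have g0_a: "g0 y (a j) = max 0 (y j)" if "j \<le> n" for y j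
  proof -
    have "g0 y (a j) = (\<Sum>i\<le>n. if i = j then max 0 (y i) else 0)"
      unfolding g0_def using distinct that by (intro sum.cong) auto
    then show ?thesis using that by simp
  qed
  have g0_b: "g0 y (b j) = max 0 (- y j)" if "j \<le> n" for y j
  proof -
    have "g0 y (b j) = (\<Sum>i\<le>n. if i = j then max 0 (- y i) else 0)"
      unfolding g0_def using distinct that by (intro sum.cong) (auto simp: eq_commute)
    then show ?thesis using that by simp
  qed
  have g0_R: "g0 y v = 0" if "v \<notin> ?R" for y v
    using that unfolding g0_def by (intro sum.neutral) auto
  have X_R: "x v = 0" if "x \<in> ?X" "v \<notin> ?R" for x v
    using that by (auto simp: order_complex_def)
  \<comment> \<open>Opposite vertices never share a simplex, so nothing cancels in
    \<open>d x j\<close>: it determines both weights, and its absolute value is their sum.\<close>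
  have X_ab: "x (a j) = 0 \<or> x (b j) = 0" if "x \<in> ?X" "j \<le> n" for x j
    using that unfolding order_complex_antichain_tower[OF le tower] by (auto simp: less_Suc_eq_le)
  have X_d: "x (a j) = max 0 (d x j)" "x (b j) = max 0 (- d x j)" "\<bar>d x j\<bar> = x (a j) + x (b j)"
    if x: "x \<in> ?X" and j: "j \<le> n" for x j
  proof -
    have "0 \<le> x (a j)" "0 \<le> x (b j)"
      using x by auto
    then show "x (a j) = max 0 (d x j)" "x (b j) = max 0 (- d x j)" "\<bar>d x j\<bar> = x (a j) + x (b j)"
      using X_ab[OF x j] by (auto simp: d_def)
  qed
  have X_l1: "(\<Sum>j\<le>n. \<bar>d x j\<bar>) = 1" if x: "x \<in> ?X" for x
  proof -
    have "(\<Sum>j\<le>n. \<bar>d x j\<bar>) = (\<Sum>j\<le>n. x (a j) + x (b j))"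
      by (intro sum.cong) (use X_d(3)[OF x] in auto)
    then show ?thesis
      using x sum_R[of x] by simp
  qed
  have pos: "0 < (\<Sum>j\<le>n. (y j)\<^sup>2)" if "(\<Sum>j\<le>n. \<bar>y j\<bar>) \<noteq> 0" for y :: "nat \<Rightarrow> real"
  proof -
    have "\<exists>j\<le>n. y j \<noteq> 0"
      using that by (metis (mono_tags, lifting) abs_zero atMost_iff sum.neutral)
    then show ?thesis
      by (auto intro!: sum_pos2)
  qed
  have f_Y: "f x \<in> ?Y" if x: "x \<in> ?X" for x
  proof -
    have "(\<Sum>j\<le>n. (f x j)\<^sup>2) = (\<Sum>j\<le>n. (d x j)\<^sup>2) / (\<Sum>j\<le>n. (d x j)\<^sup>2)"
      unfolding sum_divide_distrib
      by (intro sum.cong) (auto simp: f_def power_divide sum_nonneg)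
    then show ?thesis
      using pos[of "d x"] X_l1[OF x] by (simp add: f_def)
  qed
  have Y_l1: "0 < (\<Sum>j\<le>n. \<bar>y j\<bar>)" if y: "y \<in> ?Y" for y
  proof -
    have "\<exists>j\<le>n. y j \<noteq> 0"
      using y by (metis (mono_tags, lifting) atMost_iff mem_Collect_eq sum.neutral zero_neq_one zero_power2)
    then show ?thesis
      by (auto intro!: sum_pos2)
  qed
  have g_X: "g y \<in> ?X" if y: "y \<in> ?Y" for y
  proof -
    have "g y (a j) = 0 \<or> g y (b j) = 0" if "j \<le> n" for j
      using that by (auto simp: g_def g0_a g0_b)
    then have "{v. g y v \<noteq> 0} \<in> order_complex le ?R"
      unfolding order_complex_antichain_tower[OF le tower] using g0_R by (force simp: g_def)
    moreover have "sum (g y) ?R = 1"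
    proof -
      have "sum (g y) ?R = (\<Sum>j\<le>n. \<bar>y j\<bar>) / (\<Sum>j\<le>n. \<bar>y j\<bar>)"
        unfolding sum_R sum_divide_distrib
        by (intro sum.cong) (auto simp: g_def g0_a g0_b max_def simp flip: add_divide_distrib)
      then show ?thesis
        using Y_l1[OF y] by simp
    qed
    moreover have "0 \<le> g y v" for v
      unfolding g_def g0_def by (intro divide_nonneg_nonneg sum_nonneg) auto
    ultimately show ?thesis
      by blast
  qed
  have gf: "g (f x) = x" if x: "x \<in> ?X" for x
  proof
    fix v
    define N where "N = sqrt (\<Sum>i\<le>n. (d x i)\<^sup>2)"
    have N: "N > 0"
      using pos[of "d x"] X_l1[OF x] by (simp add: N_def)
    have l1: "(\<Sum>j\<le>n. \<bar>f x j\<bar>) = 1 / N"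
    proof -
      have "(\<Sum>j\<le>n. \<bar>f x j\<bar>) = (\<Sum>j\<le>n. \<bar>d x j\<bar>) / N"
        unfolding sum_divide_distrib by (intro sum.cong) (use N in \<open>auto simp: f_def simp flip: N_def\<close>)
      then show ?thesis
        using X_l1[OF x] by simp
    qed
    have f_N: "f x j = d x j / N" if "j \<le> n" for j
      using that by (simp add: f_def N_def)
    \<comment> \<open>Positive parts commute with positive scaling, so the factor
      \<open>1 / N\<close> introduced by \<open>f\<close> cancels in \<open>g\<close>.\<close>
    have max_N: "max 0 (t / N) / (1 / N) = max 0 t" for t
      using N by (auto simp: max_def zero_le_divide_iff divide_le_0_iff)
    have ab: "g (f x) (a j) = x (a j)" "g (f x) (b j) = x (b j)" if "j \<le> n" for j
      unfolding g_def l1 g0_a[OF that] g0_b[OF that] f_N[OF that] minus_divide_left max_N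
      using X_d(1,2)[OF x that] by simp_all
    show "g (f x) v = x v"
    proof (cases "v \<in> ?R")
      case True
      then show ?thesis using ab by auto
    next
      case False
      then show ?thesis using g0_R X_R[OF x] by (simp add: g_def)
    qed
  qed
  have fg: "f (g y) = y" if y: "y \<in> ?Y" for y
  proof
    fix j
    define N where "N = (\<Sum>j\<le>n. \<bar>y j\<bar>)"
    have N: "N > 0"
      using Y_l1[OF y] by (simp add: N_def)
    have dg: "d (g y) i = y i / N" if "i \<le> n" for i
      using that by (auto simp: d_def g_def g0_a g0_b max_def simp flip: N_def)
    then have "(\<Sum>i\<le>n. (d (g y) i)\<^sup>2) = (\<Sum>i\<le>n. (y i)\<^sup>2) / N\<^sup>2"
      unfolding sum_divide_distrib by (intro sum.cong) (auto simp: power_divide)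
    then have "sqrt (\<Sum>i\<le>n. (d (g y) i)\<^sup>2) = 1 / N"
      using y N by (simp add: real_sqrt_divide)
    then show "f (g y) j = y j"
      using y N dg by (auto simp: f_def)
  qed
  have "continuous_map (subtopology (powertop_real UNIV) ?X) euclideanreal (\<lambda>x. f x j)" for j
  proof (cases "j \<le> n")
    case True
    have "sqrt (\<Sum>i\<le>n. (d x i)\<^sup>2) \<noteq> 0" if "x \<in> ?X" for x
      using pos[of "d x"] X_l1[OF that] by simp
    then show ?thesis
      using True unfolding f_def d_def
      by (simp, intro continuous_intros continuous_map_real_coordinate) auto
  qed (simp add: f_def)
  then have f_cont: "continuous_map (subtopology (powertop_real UNIV) ?X) (subtopology (powertop_real UNIV) ?Y) f"
    unfolding continuous_map_in_subtopology continuous_map_componentwise_UNIV using f_Y by auto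
  have "continuous_map (subtopology (powertop_real UNIV) ?Y) euclideanreal (\<lambda>y. g y v)" for v
  proof -
    have "continuous_map (subtopology (powertop_real UNIV) ?Y) euclideanreal
        (\<lambda>y. if v = a j then max 0 (y j) else if v = b j then max 0 (- y j) else 0)" for j
      by (cases "v = a j"; cases "v = b j"; simp)
        (intro continuous_intros continuous_map_real_coordinate)+
    then have "continuous_map (subtopology (powertop_real UNIV) ?Y) euclideanreal (\<lambda>y. g0 y v)"
      unfolding g0_def by (intro continuous_map_sum) auto
    moreover have "(\<Sum>j\<le>n. \<bar>y j\<bar>) \<noteq> 0" if "y \<in> ?Y" for y
      using Y_l1[OF that] by simp
    ultimately show ?thesis
      unfolding g_def
      by (intro continuous_intros continuous_map_real_coordinate) auto
  qed
  then have g_cont: "continuous_map (subtopology (powertop_real UNIV) ?Y) (subtopology (powertop_real UNIV) ?X) g"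
    unfolding continuous_map_in_subtopology continuous_map_componentwise_UNIV using g_X by auto
  have "homeomorphic_maps (subtopology (powertop_real UNIV) ?X) (subtopology (powertop_real UNIV) ?Y) f g"
    unfolding homeomorphic_maps_def using f_cont g_cont gf fg by auto
  then show ?thesis
    unfolding X nsphere by (rule homeomorphic_maps_imp_homeomorphic_space)
qed

section \<open>Retractions of posets\<close>

text \<open>
  An elementary retraction is contiguous to the identity, i.e. it moves every chain inside a chain
  containing it, so the straight-line homotopy is available. A closure operator need not have this
  property: \<open>f x\<close> and \<open>y\<close> may be incomparable for \<open>x \<le> y\<close>.
\<close>

definition elementary_retract :: "('v \<Rightarrow> 'v \<Rightarrow> bool) \<Rightarrow> 'v set \<Rightarrow> 'v set \<Rightarrow> bool" where
  "elementary_retract le P R \<longleftrightarrow> R \<subseteq> P \<and>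
     (\<exists>f. f ` P \<subseteq> R \<and> (\<forall>x\<in>R. f x = x) \<and>
        (\<forall>x\<in>P. \<forall>y\<in>P. le x y \<longrightarrow>
          (le x (f y) \<or> le (f y) x) \<and> (le (f x) y \<or> le y (f x)) \<and> (le (f x) (f y) \<or> le (f y) (f x))))"

lemma order_complex_subset:
  assumes "C \<in> order_complex le P" "D \<subseteq> C"
  shows "D \<in> order_complex le P"
  using assms by (auto simp: order_complex_def Complete_Partial_Order.chain_def intro: finite_subset)

lemma elementary_retract_homotopy_equivalent:
  assumes "finite P" "elementary_retract le P R"
  shows "geometric_realization (order_complex le P) homotopy_equivalent_space
         geometric_realization (order_complex le R)"
proof -
  obtain f where RP: "R \<subseteq> P" and f: "f ` P \<subseteq> R" "\<And>x. x \<in> R \<Longrightarrow> f x = x"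
    and comp: "\<And>x y. x \<in> P \<Longrightarrow> y \<in> P \<Longrightarrow> le x y \<Longrightarrow>
      (le x (f y) \<or> le (f y) x) \<and> (le (f x) y \<or> le y (f x)) \<and> (le (f x) (f y) \<or> le (f y) (f x))"
    using assms(2) unfolding elementary_retract_def by blast
  have contig: "C \<union> f ` C \<in> order_complex le P" if "C \<in> order_complex le P" for C
  proof -
    have C: "finite C" "C \<subseteq> P" "\<And>x y. x \<in> C \<Longrightarrow> y \<in> C \<Longrightarrow> le x y \<or> le y x"
      using that by (auto simp: order_complex_def Complete_Partial_Order.chain_def)
    \<comment> \<open>Two elements of a chain are ordered one way or the other, and exchanging
      \<open>x\<close> and \<open>y\<close> swaps the first two clauses of \<open>comp\<close>, so
      both orders are covered.\<close>
    have "le x (f y) \<or> le (f y) x" "le (f x) (f y) \<or> le (f y) (f x)" if "x \<in> C" "y \<in> C" for x y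
      using C(2,3) comp that by blast+
    then have "Complete_Partial_Order.chain le (C \<union> f ` C)"
      using C(3) unfolding Complete_Partial_Order.chain_def by blast
    moreover have "f ` C \<subseteq> P"
      using C(2) f(1) RP by blast
    ultimately show ?thesis
      using C(1,2) by (simp add: order_complex_def)
  qed
  have "order_complex le P \<subseteq> Pow P"
    by (auto simp: order_complex_def)
  note geometric_realization_retract[OF assms(1) this order_complex_subset f(1) RP f(2) contig]
  moreover have "{C \<in> order_complex le P. C \<subseteq> R} = order_complex le R"
    using RP by (auto simp: order_complex_def)
  ultimately show ?thesis by simp
qed

lemma elementary_retracts_subset: "(elementary_retract le)\<^sup>*\<^sup>* P R \<Longrightarrow> R \<subseteq> P"
  by (induction rule: rtranclp_induct) (auto simp: elementary_retract_def)

lemma elementary_retracts_homotopy_equivalent: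
  assumes "(elementary_retract le)\<^sup>*\<^sup>* P R" "finite P"
  shows "geometric_realization (order_complex le P) homotopy_equivalent_space
         geometric_realization (order_complex le R)"
  using assms
proof (induction rule: rtranclp_induct)
  case base
  show ?case by (rule homotopy_equivalent_space_refl)
next
  case (step Q R)
  then show ?case
    by (meson elementary_retract_homotopy_equivalent elementary_retracts_subset finite_subset
        homotopy_eqv_trans)
qed

text \<open>The retraction is extended by the identity on \<open>T\<close>. Mixed pairs stay
  comparable since all of \<open>P\<close> lies below all of \<open>T\<close>.\<close>

lemma elementary_retract_Un:
  assumes "elementary_retract le P R" "P \<inter> T = {}" "\<And>x t. x \<in> P \<Longrightarrow> t \<in> T \<Longrightarrow> le x t"
  shows "elementary_retract le (P \<union> T) (R \<union> T)"
proof -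
  obtain f where RP: "R \<subseteq> P" and f: "f ` P \<subseteq> R" "\<And>x. x \<in> R \<Longrightarrow> f x = x"
    and comp: "\<And>x y. x \<in> P \<Longrightarrow> y \<in> P \<Longrightarrow> le x y \<Longrightarrow>
      (le x (f y) \<or> le (f y) x) \<and> (le (f x) y \<or> le y (f x)) \<and> (le (f x) (f y) \<or> le (f y) (f x))"
    using assms(1) unfolding elementary_retract_def by blast
  define g where "g x = (if x \<in> P then f x else x)" for x
  have fP: "f x \<in> P" if "x \<in> P" for x
    using that f(1) RP by blast
  have "(le x (g y) \<or> le (g y) x) \<and> (le (g x) y \<or> le y (g x)) \<and> (le (g x) (g y) \<or> le (g y) (g x))"
    if "x \<in> P \<union> T" "y \<in> P \<union> T" "le x y" for x y
    using that comp[of x y] fP assms(3) by (auto simp: g_def)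
  moreover have "g ` (P \<union> T) \<subseteq> R \<union> T" "\<forall>x\<in>R \<union> T. g x = x"
    using RP f assms(2) by (auto simp: g_def)
  ultimately show ?thesis
    using RP unfolding elementary_retract_def by (intro conjI exI[of _ g]) auto
qed

lemma elementary_retracts_Un:
  assumes "(elementary_retract le)\<^sup>*\<^sup>* P R" "P \<inter> T = {}" "\<And>x t. x \<in> P \<Longrightarrow> t \<in> T \<Longrightarrow> le x t"
  shows "(elementary_retract le)\<^sup>*\<^sup>* (P \<union> T) (R \<union> T)"
  using assms(1)
proof (induction rule: rtranclp_induct)
  case (step Q R)
  have "elementary_retract le (Q \<union> T) (R \<union> T)"
    using elementary_retracts_subset[OF step.hyps(1)] assms(2,3)
    by (intro elementary_retract_Un[OF step.hyps(2)]) auto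
  with step.IH show ?case by simp
qed simp

text \<open>Let \<open>x\<close> be below \<open>y\<close>. If \<open>y\<close> is moved up to
  \<open>p\<close>, then \<open>x\<close> is below \<open>p\<close> too and is either fixed or moved
  to \<open>p\<close>; likewise for \<open>s\<close>. If \<open>y\<close> is below both tops, so is
  \<open>x\<close>, and both are fixed.\<close>

lemma elementary_retract_two_tops:
  assumes "reflp le" "transp le" "p \<in> P" "s \<in> P" "\<And>x. x \<in> P \<Longrightarrow> le x p \<or> le x s"
  shows "elementary_retract le P ({x \<in> P. le x p \<and> le x s} \<union> {p, s})"
proof -
  define f where "f x = (if le x p \<and> le x s then x else if le x p then p else s)" for x
  have "(le x (f y) \<or> le (f y) x) \<and> (le (f x) y \<or> le y (f x)) \<and> (le (f x) (f y) \<or> le (f y) (f x))"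
    if "x \<in> P" "y \<in> P" "le x y" for x y
  proof -
    have xy: "le y p \<Longrightarrow> le x p" "le y s \<Longrightarrow> le x s"
      using that(3) transpD[OF assms(2)] by blast+
    have refl: "le v v" for v
      using assms(1) by (rule reflpD)
    show ?thesis
      using that xy assms(5)[OF that(1)] assms(5)[OF that(2)] refl by (auto simp: f_def)
  qed
  moreover have "f p = p" "f s = s"
    using reflpD[OF assms(1)] by (auto simp: f_def)
  ultimately show ?thesis
    using assms(3-5) unfolding elementary_retract_def
    by (intro conjI exI[of _ f]) (auto simp: f_def)
qed

section \<open>Cones and towers as end results of retractions\<close>

definition cone_or_tower :: "('v \<Rightarrow> 'v \<Rightarrow> bool) \<Rightarrow> 'v set \<Rightarrow> bool" where
  "cone_or_tower le R \<longleftrightarrow>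
     (\<exists>m\<in>R. \<forall>x\<in>R. le x m \<or> le m x) \<or>
     (\<exists>k a b. antichain_tower le k a b \<and> R = a ` {..<k} \<union> b ` {..<k})"

lemma cone_or_tower_cone: "m \<in> R \<Longrightarrow> \<forall>x\<in>R. le x m \<or> le m x \<Longrightarrow> cone_or_tower le R"
  unfolding cone_or_tower_def by blast

lemma cone_or_tower_empty: "cone_or_tower le {}"
  unfolding cone_or_tower_def antichain_tower_def by (intro disjI2 exI[of _ 0]) simp

text \<open>A cone point of \<open>R\<close> lies below \<open>c\<close> and \<open>d\<close> and
  hence remains one; a tower gains a top level with index \<open>k\<close>.\<close>

lemma cone_or_tower_Un:
  assumes "cone_or_tower le R" "\<not> le c d" "\<not> le d c" "\<And>x. x \<in> R \<Longrightarrow> le x c \<and> le x d"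
  shows "cone_or_tower le (R \<union> {c, d})"
proof -
  consider m where "m \<in> R" "\<forall>x\<in>R. le x m \<or> le m x"
    | k a b where "antichain_tower le k a b" "R = a ` {..<k} \<union> b ` {..<k}"
    using assms(1) unfolding cone_or_tower_def by blast
  then show ?thesis
  proof cases
    case 1
    then have "\<forall>x\<in>R \<union> {c, d}. le x m \<or> le m x"
      using assms(4)[of m] by auto
    then show ?thesis
      using \<open>m \<in> R\<close> by (intro cone_or_tower_cone[of m]) auto
  next
    case (2 k a b)
    have "antichain_tower le (Suc k) (a(k := c)) (b(k := d))"
      using 2(1) assms(2-4) by (simp add: antichain_tower_def 2(2) less_Suc_eq)
    moreover have "R \<union> {c, d} = (a(k := c)) ` {..<Suc k} \<union> (b(k := d)) ` {..<Suc k}"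
      by (simp add: 2(2) lessThan_Suc) blast
    ultimately show ?thesis
      unfolding cone_or_tower_def by blast
  qed
qed

lemma cone_or_tower_sphere_or_contractible:
  assumes "reflp le" "finite R" "cone_or_tower le R"
  shows "(\<exists>d\<ge>-1. geometric_realization (order_complex le R) homotopy_equivalent_space sphere_space d)
         \<or> contractible_nonempty_space (geometric_realization (order_complex le R))"
  using assms(3) unfolding cone_or_tower_def
proof (elim disjE exE conjE bexE)
  fix m assume m: "m \<in> R" "\<forall>x\<in>R. le x m \<or> le m x"
  have "contractible_nonempty_space (geometric_realization (order_complex le R))"
  proof (rule geometric_realization_cone[OF assms(2)])
    show "order_complex le R \<subseteq> Pow R"
      by (auto simp: order_complex_def)
    show "{m} \<in> order_complex le R"
      using m reflpD[OF assms(1)] by (auto simp: order_complex_def Complete_Partial_Order.chain_def)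
    show "insert m C \<in> order_complex le R" if "C \<in> order_complex le R" for C
      using that m reflpD[OF assms(1)]
      by (auto simp: order_complex_def Complete_Partial_Order.chain_def)
  qed (rule order_complex_subset)
  then show ?thesis ..
next
  fix k a b assume tower: "antichain_tower le k a b" and R: "R = a ` {..<k} \<union> b ` {..<k}"
  show ?thesis
  proof (cases k)
    case 0
    \<comment> \<open>Without levels only the empty simplex is left, and no point supported on it
      has coordinate sum 1: this is the sphere of dimension -1.\<close>
    then have "topspace (geometric_realization (order_complex le R)) = {}"
      by (auto simp: R order_complex_def geometric_realization_def)
    then have "geometric_realization (order_complex le R) homeomorphic_space sphere_space (-1)"
      by (simp add: sphere_space_def homeomorphic_empty_space_eq)
    then show ?thesis
      by (intro disjI1 exI[of _ "-1"]) (auto intro: homeomorphic_imp_homotopy_equivalent_space)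
  next
    case (Suc n)
    have "geometric_realization (order_complex le R) homeomorphic_space nsphere n"
      using geometric_realization_antichain_tower[OF assms(1) tower[unfolded Suc]] by (simp add: R Suc)
    then have "geometric_realization (order_complex le R) homotopy_equivalent_space sphere_space (int n)"
      by (simp add: sphere_space_def homeomorphic_imp_homotopy_equivalent_space)
    then show ?thesis
      by (intro disjI1 exI[of _ "int n"]) auto
  qed
qed

text \<open>Contractibility transfers by the library result; nonemptiness needs the map from
  \<open>Y\<close> back to \<open>X\<close>.\<close>

lemma contractible_nonempty_space_homotopy_equivalent:
  assumes "X homotopy_equivalent_space Y" "contractible_nonempty_space Y"
  shows "contractible_nonempty_space X"
proof -
  obtain g where "continuous_map Y X g"
    using assms(1) by (auto simp: homotopy_equivalent_space_def)
  then have "topspace X \<noteq> {}"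
    using assms(2) continuous_map_image_subset_topspace[of Y X g]
    unfolding contractible_nonempty_space_def by blast
  then show ?thesis
    using assms homotopy_equivalent_space_contractibility[OF assms(1)]
    by (simp add: contractible_nonempty_space_def)
qed

section \<open>Factors of a word\<close>

lemma sublist_same_length: "sublist v w \<Longrightarrow> length v = length w \<Longrightarrow> v = w"
  by (auto simp: sublist_def)

text \<open>An occurrence of a proper factor misses the first or the last letter of the
  word.\<close>

lemma strict_sublist_snoc_Cons:
  "strict_sublist v (a # x @ [b]) \<longleftrightarrow> sublist v (a # x) \<or> sublist v (x @ [b])"
proof -
  have "sublist v (a # x @ [b]) \<longleftrightarrow> v = a # x @ [b] \<or> sublist v (a # x) \<or> sublist v (x @ [b])"
    using prefix_snoc[of v "a # x" b] sublist_Cons_right[of v a "x @ [b]"]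
      sublist_append[of v "a # x" "[b]"]
    by auto
  moreover have "\<not> sublist (a # x @ [b]) (a # x)" "\<not> sublist (a # x @ [b]) (x @ [b])"
    by (auto dest: sublist_length_le)
  ultimately show ?thesis
    by (auto simp: strict_sublist_def)
qed

section \<open>Borders of a word\<close>

definition border :: "'a list \<Rightarrow> 'a list \<Rightarrow> bool" where
  "border v w \<longleftrightarrow> strict_prefix v w \<and> strict_suffix v w"

text \<open>The empty word is a border and lengths are bounded, so a longest border exists. Of two
  prefixes of \<open>w\<close> the shorter is a prefix of the longer, so every border is a prefix of
  the longest one.\<close>

lemma longest_border:
  assumes "w \<noteq> []"
  obtains z where "border z w" "\<And>v. border v w \<Longrightarrow> prefix v z"
proof -
  have "border [] w"
    using assms by (auto simp: border_def strict_prefix_def strict_suffix_def)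
  moreover have "\<forall>v. border v w \<longrightarrow> length v \<le> length w"
    by (auto simp: border_def strict_prefix_def dest: prefix_length_le)
  ultimately obtain z where z: "border z w" "\<forall>v. border v w \<longrightarrow> length v \<le> length z"
    using ex_has_greatest_nat[of "\<lambda>v. border v w" "[]" length "Suc (length w)"]
    by (auto simp: less_Suc_eq_le)
  show thesis
  proof
    show "prefix v z" if "border v w" for v
      using that z by (auto simp: border_def strict_prefix_def intro: prefix_length_prefix)
  qed (rule z(1))
qed

lemma border_sublist:
  assumes "border v (a # x @ [b])"
  shows "sublist v (a # x)" "sublist v (x @ [b])"
proof -
  show "sublist v (a # x)"
    using assms by (metis append_Cons border_def prefix_snoc strict_prefix_def prefix_imp_sublist)
  show "sublist v (x @ [b])"
    using assms by (metis border_def strict_suffix_def suffix_Cons suffix_imp_sublist)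
qed

text \<open>A common factor of \<open>a # x\<close> and \<open>x @ [b]\<close> that is not a factor
  of \<open>x\<close> must start at the first letter of the one and end at the last letter of the
  other, so it is a border of the whole word.\<close>

lemma sublist_both_iff:
  assumes z: "border z (a # x @ [b])" "\<And>v. border v (a # x @ [b]) \<Longrightarrow> prefix v z"
  shows "sublist v (a # x) \<and> sublist v (x @ [b]) \<longleftrightarrow> sublist v x \<or> sublist v z"
proof
  assume v: "sublist v (a # x) \<and> sublist v (x @ [b])"
  show "sublist v x \<or> sublist v z"
  proof (cases "sublist v x")
    case False
    then have "prefix v (a # x)" "suffix v (x @ [b])"
      using v by (auto simp: sublist_Cons_right sublist_snoc)
    then have "border v (a # x @ [b])"
      unfolding border_def strict_prefix_def strict_suffix_def
      by (metis append_Cons prefix_snoc suffix_ConsI v strict_sublist_def strict_sublist_snoc_Cons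
          sublist_order.less_irrefl)
    then show ?thesis
      using z(2) by blast
  qed simp
next
  assume "sublist v x \<or> sublist v z"
  then show "sublist v (a # x) \<and> sublist v (x @ [b])"
    using border_sublist[OF z(1)]
    by (meson sublist_order.order.trans sublist_Cons_right sublist_append_rightI)
qed

text \<open>Removing the first letter from the prefix occurrence of \<open>z\<close>, or the last
  letter from its suffix occurrence, leaves an occurrence inside \<open>x\<close>. A proper factor
  of \<open>z\<close> survives one of these removals.\<close>

lemma strict_sublist_border:
  assumes z: "border z (a # x @ [b])" and v: "strict_sublist v z"
  shows "sublist v x"
proof -
  consider "z = []" | c where "z = [c]" | c y d where "z = c # y @ [d]"
    by (metis neq_Nil_conv rev_exhaust)
  then show ?thesis
  proof cases
    case 1
    then show ?thesis
      using v by (simp add: strict_sublist_def)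
  next
    case 2
    then show ?thesis
      using v by (auto simp: strict_sublist_def sublist_Cons_right Cons_eq_append_conv prefix_def)
  next
    case zy: (3 c y d)
    have "prefix (y @ [d]) (x @ [b])" "y @ [d] \<noteq> x @ [b]" 
      using z zy by (auto simp: border_def strict_prefix_def)
    then have 1: "prefix (y @ [d]) x"
      by (simp add: prefix_snoc del: append1_eq_conv)
    have "suffix (c # y) (a # x)" "c # y \<noteq> a # x"
      using z zy snoc_suffix_snoc[of "c # y" d "a # x" b]
      by (auto simp: border_def strict_prefix_def strict_suffix_def)
    then have 2: "suffix (c # y) x"
      by (auto simp: suffix_Cons)
    from v have "sublist v (c # y) \<or> sublist v (y @ [d])"
      unfolding zy strict_sublist_snoc_Cons .
    then show ?thesis
      using 1 2 by (meson sublist_order.order.trans prefix_imp_sublist suffix_imp_sublist)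
  qed
qed

text \<open>In the induction \<open>u\<close> stays fixed while \<open>w\<close> is replaced by its
  longest border. The alphabet is left out, so nothing about letters has to be carried
  along.\<close>

lemma factor_interval_retracts:
  "\<exists>R. (elementary_retract sublist)\<^sup>*\<^sup>* {v. strict_sublist u v \<and> strict_sublist v w} R
       \<and> cone_or_tower sublist R"
proof (induction "length w" arbitrary: w rule: less_induct)
  case less
  define P where "P w = {v. strict_sublist u v \<and> strict_sublist v w}" for w
  have "\<exists>R. (elementary_retract sublist)\<^sup>*\<^sup>* (P w) R \<and> cone_or_tower sublist R"
  proof (cases "P w = {}")
    case True
    then have "cone_or_tower sublist (P w)"
      by (simp add: cone_or_tower_empty)
    then show ?thesis by blast
  next
    case False
    then obtain v where v: "strict_sublist u v" "strict_sublist v w"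
      by (auto simp: P_def)
    have refl: "reflp (sublist :: 'a list \<Rightarrow> _)" and trans: "transp (sublist :: 'a list \<Rightarrow> _)"
      by (auto intro: reflpI transpI)
    \<comment> \<open>A proper factor of a one-letter word is empty and has no proper factor
      \<open>u\<close>, so a nonempty interval forces \<open>w\<close> to have at least two
      letters.\<close>
    have "\<not> (\<exists>c. w = [c])" "w \<noteq> []"
      using v by (auto simp: strict_sublist_def sublist_Cons_right Cons_eq_append_conv prefix_def)
    then obtain a x b where w: "w = a # x @ [b]"
      by (metis neq_Nil_conv rev_exhaust)
    define p s where "p = a # x" and "s = x @ [b]"
    have below_w: "strict_sublist v w \<longleftrightarrow> sublist v p \<or> sublist v s" for v
      by (simp add: w p_def s_def strict_sublist_snoc_Cons)
    have P_iff: "v \<in> P w \<longleftrightarrow> strict_sublist u v \<and> (sublist v p \<or> sublist v s)" for v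
      by (simp add: P_def below_w)
    show ?thesis
    proof (cases "p \<in> P w \<and> s \<in> P w \<and> p \<noteq> s")
      case False
      \<comment> \<open>If \<open>u\<close> is not properly below \<open>s\<close>, then no element
        of the interval is below \<open>s\<close> and all lie below \<open>p\<close>; likewise with
        the roles exchanged. If \<open>p = s\<close>, this word bounds everything. So the interval
        has a maximum, which is a cone point.\<close>
      have "cone_or_tower sublist (P w)"
      proof (cases "strict_sublist u s \<and> (p = s \<or> \<not> strict_sublist u p)")
        case True
        then have "\<forall>x\<in>P w. sublist x s"
          using sublist_order.less_le_trans[of u _ p] by (auto simp: P_iff)
        then show ?thesis
          using True by (intro cone_or_tower_cone[of s]) (auto simp: P_iff)
      next
        case s: False
        then have "\<not> strict_sublist u s"
          using False by (auto simp: P_iff)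
        then have "\<forall>x\<in>P w. sublist x p"
          using sublist_order.less_le_trans[of u _ s] by (auto simp: P_iff)
        moreover from this have "p \<in> P w"
          using \<open>P w \<noteq> {}\<close> sublist_order.less_le_trans[of u _ p] by (auto simp: P_iff)
        ultimately show ?thesis
          by (intro cone_or_tower_cone[of p]) auto
      qed
      then show ?thesis
        by blast
    next
      case True
      then have ps: "p \<in> P w" "s \<in> P w" "p \<noteq> s" by auto
      \<comment> \<open>Distinct words of equal length are incomparable.\<close>
      have incomparable: "\<not> sublist p s" "\<not> sublist s p"
        using ps(3) by (auto simp: p_def s_def dest!: sublist_same_length)
      obtain z where z: "border z w" "\<And>v. border v w \<Longrightarrow> prefix v z"
        using longest_border \<open>w \<noteq> []\<close> by blast
      have both: "sublist v p \<and> sublist v s \<longleftrightarrow> sublist v x \<or> sublist v z" for v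
        unfolding p_def s_def by (rule sublist_both_iff) (use z in \<open>auto simp: w\<close>)
      \<comment> \<open>The part of the interval below both \<open>p\<close> and \<open>s\<close>,
        described through \<open>x\<close> and \<open>z\<close>, which serve as the next pair of
        tops.\<close>
      define Q where "Q = {v. strict_sublist u v \<and> (sublist v x \<or> sublist v z)}"
      have "{v \<in> P w. sublist v p \<and> sublist v s} = Q"
        unfolding Q_def both[symmetric] by (auto simp: P_iff)
      then have PQ: "elementary_retract sublist (P w) (Q \<union> {p, s})"
        using elementary_retract_two_tops[OF refl trans ps(1,2)] by (auto simp: P_iff)
      have Q_below: "sublist v p" "sublist v s" if "v \<in> Q" for v
        using that both by (auto simp: Q_def)
      have Q_disjoint: "Q \<inter> {p, s} = {}"
        using Q_below incomparable by auto
      have "\<exists>R. (elementary_retract sublist)\<^sup>*\<^sup>* Q R \<and> cone_or_tower sublist R"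
      proof (cases "x \<in> Q \<and> z \<in> Q \<and> \<not> sublist z x")
        case False
        \<comment> \<open>If \<open>z\<close> lies below \<open>x\<close>, or one of the two is not
          properly above \<open>u\<close>, then a single one of them bounds all of \<open>Q\<close>
          and belongs to \<open>Q\<close> once \<open>Q\<close> is nonempty.\<close>
        have "Q = {} \<or> (\<exists>m\<in>Q. \<forall>v\<in>Q. sublist v m)"
        proof (cases "x \<in> Q")
          case True
          then have "\<forall>v\<in>Q. sublist v x"
            using False sublist_order.less_le_trans[of u _ z] sublist_order.order.trans[of _ z x]
            by (auto simp: Q_def)
          with True show ?thesis by blast
        next
          case xQ: False
          then have "\<forall>v\<in>Q. sublist v z \<and> z \<in> Q"
            using sublist_order.less_le_trans[of u] by (auto simp: Q_def)
          then show ?thesis by blast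
        qed
        then have "cone_or_tower sublist Q"
          using cone_or_tower_cone[of _ Q sublist] cone_or_tower_empty[of sublist] by auto
        then show ?thesis by blast
      next
        case True
        then have xz: "x \<in> Q" "z \<in> Q" "\<not> sublist z x" by auto
        \<comment> \<open>As a factor of \<open>p\<close>, \<open>z\<close> is at most one letter
          longer than \<open>x\<close>. If \<open>x\<close> were below \<open>z\<close>, then
          \<open>z\<close> would equal \<open>x\<close>, or have the length of \<open>p\<close> and
          \<open>s\<close> and so equal both.\<close>
        have zx: "\<not> sublist x z"
        proof
          assume "sublist x z"
          moreover have "sublist z p" "sublist z s"
            using both by auto
          ultimately have "x = z \<or> z = p \<and> z = s"
            using sublist_same_length[of x z] sublist_same_length[of z p] sublist_same_length[of z s]
              sublist_length_le[of x z] sublist_length_le[of z p]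
            by (fastforce simp: p_def s_def)
          then show False
            using xz(3) ps(3) by blast
        qed
        \<comment> \<open>The common lower part of \<open>x\<close> and \<open>z\<close> is again an
          open interval: \<open>z\<close> itself is excluded as it is not below \<open>x\<close>,
          and all its proper factors are below \<open>x\<close>. The induction hypothesis applies to
          it.\<close>
        have "{v \<in> Q. sublist v x \<and> sublist v z} = P z"
          using xz(3) strict_sublist_border[OF z(1)[unfolded w]]
          by (auto simp: P_def Q_def strict_sublist_def)
        then have "elementary_retract sublist Q (P z \<union> {x, z})"
          using elementary_retract_two_tops[OF refl trans xz(1,2)] by (auto simp: Q_def)
        moreover
        have "length z < length w"
          using z(1) by (auto simp: border_def dest: prefix_length_less)
        then obtain R where R: "(elementary_retract sublist)\<^sup>*\<^sup>* (P z) R" "cone_or_tower sublist R"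
          using less.hyps[of z] by (auto simp: P_def)
        have Pz: "sublist v x \<and> sublist v z" if "v \<in> P z" for v
          using that strict_sublist_border[OF z(1)[unfolded w]] by (auto simp: P_def strict_sublist_def)
        then have "(elementary_retract sublist)\<^sup>*\<^sup>* (P z \<union> {x, z}) (R \<union> {x, z})"
          using xz(3) zx by (intro elementary_retracts_Un R) auto
        moreover have "cone_or_tower sublist (R \<union> {x, z})"
          using xz(3) zx Pz elementary_retracts_subset[OF R(1)] by (intro cone_or_tower_Un R) auto
        ultimately show ?thesis
          by (meson converse_rtranclp_into_rtranclp)
      qed
      then obtain R where R: "(elementary_retract sublist)\<^sup>*\<^sup>* Q R" "cone_or_tower sublist R"
        by blast
      have "(elementary_retract sublist)\<^sup>*\<^sup>* (Q \<union> {p, s}) (R \<union> {p, s})"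
        using Q_disjoint Q_below by (intro elementary_retracts_Un R) auto
      with PQ have "(elementary_retract sublist)\<^sup>*\<^sup>* (P w) (R \<union> {p, s})"
        by (meson converse_rtranclp_into_rtranclp)
      moreover have "cone_or_tower sublist (R \<union> {p, s})"
        using incomparable Q_below elementary_retracts_subset[OF R(1)] by (intro cone_or_tower_Un R) auto
      ultimately show ?thesis by blast
    qed
  qed
  then show ?case by (simp add: P_def)
qed

theorem theorem2p7:
  fixes A :: "'a set" and u w :: "'a list"
  assumes "u \<in> lists A" and "w \<in> lists A" and "sublist u w"
  shows "(\<exists>d\<ge>-1. geometric_realization (factor_order_complex A u w)
                    homotopy_equivalent_space sphere_space d)
         \<or> contractible_nonempty_space (geometric_realization (factor_order_complex A u w))"
proof -
  \<comment> \<open>The letters of a factor of \<open>w\<close> occur in \<open>w\<close>, so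
    membership in \<open>lists A\<close> is automatic.\<close>
  have P: "factor_interval A u w = {v. strict_sublist u v \<and> strict_sublist v w}"
  proof -
    have "v \<in> lists A" if "strict_sublist v w" for v
      using that assms(2) set_mono_sublist[of v w] by (auto simp: strict_sublist_def)
    then show ?thesis
      by (auto simp: factor_interval_def)
  qed
  obtain R where R: "(elementary_retract sublist)\<^sup>*\<^sup>* (factor_interval A u w) R" "cone_or_tower sublist R"
    using factor_interval_retracts[of u w] unfolding P by blast
  have "finite R"
    using elementary_retracts_subset[OF R(1)] finite_factor_interval by (rule finite_subset)
  then have "(\<exists>d\<ge>-1. geometric_realization (order_complex sublist R) homotopy_equivalent_space sphere_space d)
         \<or> contractible_nonempty_space (geometric_realization (order_complex sublist R))"
    using R(2) by (intro cone_or_tower_sphere_or_contractible) (auto intro: reflpI)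
  moreover have "geometric_realization (factor_order_complex A u w) homotopy_equivalent_space
      geometric_realization (order_complex sublist R)"
    unfolding factor_order_complex_def
    by (rule elementary_retracts_homotopy_equivalent[OF R(1) finite_factor_interval])
  ultimately show ?thesis
    by (meson contractible_nonempty_space_homotopy_equivalent homotopy_eqv_trans)
qed

end
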